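(* Let $\bar{\mathcal X}=\{\mathcal X^1,\dots,\mathcal X^d\}\in\overline{\mathcal M}_{\mathbf r}$. Then the symmetric block tridiagonal matrix $$\begin{bmatrix}\mathbf A_1&\mathbf B_1\\ \mathbf B_1^{\mathsf T}&\mathbf A_2&\mathbf B_2\\ &\ddots&\ddots&\ddots\\ &&\mathbf B_{d-2}^{\mathsf T}&\mathbf A_{d-1}\end{bmatrix}$$ of size $\sum_{k=1}^{d-1}r_k^2$, with blocks $$\mathbf A_k=\mathbf R^{k+1}\otimes\mathbf L^k\ (1\le k\le d-1),\qquad \mathbf B_k=-\tfrac12\big(R(\mathcal X^{k+1})\otimes\mathbf L^k\big)\big(\mathbf R^{k+2}\otimes L(\mathcal X^{k+1})\big)\ (1\le k\le d-2),$$ is positive definite.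
   Context: Fix integers $d\ge 2$, $n_1,\dots,n_d\ge1$ and $\mathbf r=(r_0,r_1,\dots,r_d)$ with $r_0=r_d=1$, $r_k\ge1$, $r_{k-1}\le n_kr_k$ and $r_k\le n_kr_{k-1}$ for $k=1,\dots,d$. For $\mathcal Z\in\mathbb R^{a\times b\times c}$, the left unfolding $L(\mathcal Z)\in\mathbb R^{ab\times c}$ and right unfolding $R(\mathcal Z)\in\mathbb R^{a\times bc}$ are $L(\mathcal Z)(i_1+a(i_2-1),i_3)=\mathcal Z(i_1,i_2,i_3)$ and $R(\mathcal Z)(i_1,i_2+b(i_3-1))=\mathcal Z(i_1,i_2,i_3)$. The total space $\overline{\mathcal M}_{\mathbf r}$ is the set of tuples $\bar{\mathcal X}=\{\mathcal X^1,\dots,\mathcal X^d\}$ with $\mathcal X^k\in\mathbb R^{r_{k-1}\times n_k\times r_k}$, $\operatorname{rank}L(\mathcal X^k)=r_k$ and $\operatorname{rank}R(\mathcal X^k)=r_{k-1}$ for $k=1,\dots,d$. Write $\mathcal X^k(i_k)\in\mathbb R^{r_{k-1}\times r_k}$ for the slice $\mathcal X^k(:,i_k,:)$. The interface matrices are $\mathcal X^{\le k}\in\mathbb R^{n_1\cdots n_k\times r_k}$ with row $(i_1,\dots,i_k)$ equal to $\mathcal X^1(i_1)\cdots\mathcal X^k(i_k)$, and $\mathcal X^{\ge k}\in\mathbb R^{n_k\cdots n_d\times r_{k-1}}$ with row $(i_k,\dots,i_d)$ equal to $[\mathcal X^k(i_k)\cdots\mathcal X^d(i_d)]^{\mathsf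 T}$ (multi-indices are ordered with the first index varying fastest), and $\mathcal X^{\le0}=\mathcal X^{\ge d+1}=1$. Put $\mathbf L^k=(\mathcal X^{\le k})^{\mathsf T}\mathcal X^{\le k}\in\mathbb R^{r_k\times r_k}$ and $\mathbf R^k=(\mathcal X^{\ge k})^{\mathsf T}\mathcal X^{\ge k}\in\mathbb R^{r_{k-1}\times r_{k-1}}$. $\otimes$ is the Kronecker product. *)

theory Defs
  imports "Jordan_Normal_Form.Matrix" "Jordan_Normal_Form.DL_Rank"
begin

(* Entry positions inside tensors, matrices and multi-indices count from 0, as in
   Jordan_Normal_Form; positions of cores and of blocks count from 1.
   A tensor of size a x b x c is a function that is only ever read at (i1, i2, i3)
   with i1 < a, i2 < b, i3 < c; the sizes are passed separately. *)

type_synonym tensor3 = "nat \<Rightarrow> nat \<Rightarrow> nat \<Rightarrow> real"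

definition left_unfolding :: "nat \<Rightarrow> nat \<Rightarrow> nat \<Rightarrow> tensor3 \<Rightarrow> real mat" where
  "left_unfolding a b c Z = mat (a * b) c (\<lambda>(i, i3). Z (i mod a) (i div a) i3)"

definition right_unfolding :: "nat \<Rightarrow> nat \<Rightarrow> nat \<Rightarrow> tensor3 \<Rightarrow> real mat" where
  "right_unfolding a b c Z = mat a (b * c) (\<lambda>(i1, j). Z i1 (j mod b) (j div b))"

lemma left_unfolding_index:
  assumes "i1 < a" "i2 < b" "i3 < c"
  shows "left_unfolding a b c Z $$ (i1 + a * i2, i3) = Z i1 i2 i3"
proof -
  have "i1 + a * i2 < a * Suc i2" using assms by simp
  also have "\<dots> \<le> a * b" using assms by (intro mult_le_mono) auto
  finally show ?thesis using assms by (simp add: left_unfolding_def)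
qed

lemma right_unfolding_index:
  assumes "i1 < a" "i2 < b" "i3 < c"
  shows "right_unfolding a b c Z $$ (i1, i2 + b * i3) = Z i1 i2 i3"
proof -
  have "i2 + b * i3 < b * Suc i3" using assms by simp
  also have "\<dots> \<le> b * c" using assms by (intro mult_le_mono) auto
  finally show ?thesis using assms by (simp add: right_unfolding_def)
qed

definition mat_rank :: "real mat \<Rightarrow> nat" where
  "mat_rank A = vec_space.rank (dim_row A) A"

definition kron :: "real mat \<Rightarrow> real mat \<Rightarrow> real mat" (infixl "\<otimes>\<^sub>K" 70) where
  "A \<otimes>\<^sub>K B = mat (dim_row A * dim_row B) (dim_col A * dim_col B)
     (\<lambda>(i, j). A $$ (i div dim_row B, j div dim_col B) * B $$ (i mod dim_row B, j mod dim_col B))"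

definition positive_definite :: "real mat \<Rightarrow> bool" where
  "positive_definite A \<longleftrightarrow> square_mat A \<and> A\<^sup>T = A \<and>
     (\<forall>x \<in> carrier_vec (dim_row A). x \<noteq> 0\<^sub>v (dim_row A) \<longrightarrow> x \<bullet> (A *\<^sub>v x) > 0)"

(* A core tuple X gives the k-th core as X k, of size r (k-1) x n k x r k, for k = 1..d. *)

definition core_L :: "(nat \<Rightarrow> nat) \<Rightarrow> (nat \<Rightarrow> nat) \<Rightarrow> (nat \<Rightarrow> tensor3) \<Rightarrow> nat \<Rightarrow> real mat" where
  "core_L n r X k = left_unfolding (r (k - 1)) (n k) (r k) (X k)"

definition core_R :: "(nat \<Rightarrow> nat) \<Rightarrow> (nat \<Rightarrow> nat) \<Rightarrow> (nat \<Rightarrow> tensor3) \<Rightarrow> nat \<Rightarrow> real mat" where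
  "core_R n r X k = right_unfolding (r (k - 1)) (n k) (r k) (X k)"

definition total_space :: "nat \<Rightarrow> (nat \<Rightarrow> nat) \<Rightarrow> (nat \<Rightarrow> nat) \<Rightarrow> (nat \<Rightarrow> tensor3) set" where
  "total_space d n r = {X. \<forall>k\<in>{1..d}. mat_rank (core_L n r X k) = r k \<and>
                                       mat_rank (core_R n r X k) = r (k - 1)}"

definition slice :: "(nat \<Rightarrow> nat) \<Rightarrow> (nat \<Rightarrow> tensor3) \<Rightarrow> nat \<Rightarrow> nat \<Rightarrow> real mat" where
  "slice r X k i = mat (r (k - 1)) (r k) (\<lambda>(p, q). X k p i q)"

(* X^a(f a) * ... * X^m(f m); the trailing identity makes the empty product (a = m + 1)
   the identity of size r m. *)
definition slice_prod ::
  "(nat \<Rightarrow> nat) \<Rightarrow> (nat \<Rightarrow> tensor3) \<Rightarrow> nat \<Rightarrow> nat \<Rightarrow> (nat \<Rightarrow> nat) \<Rightarrow> real mat" where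
  "slice_prod r X a m f = foldr (*) (map (\<lambda>j. slice r X j (f j)) [a..<Suc m]) (1\<^sub>m (r m))"

(* The component i_j of the multi-index (i_a, i_(a+1), ...) in linear position i, where the
   first component varies fastest; see multi_index_linear. *)
definition multi_index :: "(nat \<Rightarrow> nat) \<Rightarrow> nat \<Rightarrow> nat \<Rightarrow> nat \<Rightarrow> nat" where
  "multi_index n a i j = (i div (\<Prod>l=a..<j. n l)) mod n j"

lemma linear_index_less:
  fixes a m :: nat and f n :: "nat \<Rightarrow> nat"
  assumes "a \<le> m" "\<And>j. a \<le> j \<Longrightarrow> j < m \<Longrightarrow> f j < (n j :: nat)"
  shows "(\<Sum>j=a..<m. f j * (\<Prod>l=a..<j. n l)) < (\<Prod>l=a..<m. n l)"
  using assms
proof (induction m rule: dec_induct)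
  case base
  show ?case by simp
next
  case (step m)
  let ?P = "\<Prod>l=a..<m. n l"
  have "(\<Sum>j=a..<Suc m. f j * (\<Prod>l=a..<j. n l)) < ?P + f m * ?P"
    using step by simp
  also have "\<dots> = Suc (f m) * ?P" by simp
  also have "\<dots> \<le> n m * ?P"
    using step.prems[of m] step.hyps by (intro mult_le_mono1) auto
  also have "\<dots> = (\<Prod>l=a..<Suc m. n l)" using step.hyps by (simp add: mult.commute)
  finally show ?case .
qed

lemma multi_index_linear:
  fixes a j m :: nat and f n :: "nat \<Rightarrow> nat"
  assumes "a \<le> j" "j < m" "\<And>j. a \<le> j \<Longrightarrow> j < m \<Longrightarrow> f j < n j"
  shows "multi_index n a (\<Sum>j=a..<m. f j * (\<Prod>l=a..<j. n l)) j = f j"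
proof -
  let ?P = "\<Prod>l=a..<j. n l" and ?g = "\<lambda>j. f j * (\<Prod>l=a..<j. n l)"
  have lo: "sum ?g {a..<j} < ?P"
    using assms by (intro linear_index_less) auto
  have "?P * n j dvd ?g i" if "i \<in> {Suc j..<m}" for i
  proof -
    have "prod n {a..<Suc j} dvd prod n {a..<i}"
      using that by (intro prod_dvd_prod_subset) auto
    then show ?thesis using assms(1) by simp
  qed
  then have "?P * n j dvd sum ?g {Suc j..<m}" by (rule dvd_sum)
  then obtain c where c: "sum ?g {Suc j..<m} = ?P * n j * c" by (elim dvdE)
  have "sum ?g {a..<m} = sum ?g {a..<j} + sum ?g {j..<m}"
    using assms by (simp add: sum.atLeastLessThan_concat)
  also have "sum ?g {j..<m} = ?g j + sum ?g {Suc j..<m}"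
    using assms by (simp add: sum.atLeast_Suc_lessThan)
  finally have "sum ?g {a..<m} = sum ?g {a..<j} + ?P * (f j + n j * c)"
    by (simp add: c algebra_simps)
  then have "sum ?g {a..<m} div ?P = f j + n j * c"
    using lo div_mult_self2[of ?P "sum ?g {a..<j}" "f j + n j * c"] by (simp only: div_less)
  then show ?thesis using assms by (simp add: multi_index_def)
qed

definition interface_le ::
  "(nat \<Rightarrow> nat) \<Rightarrow> (nat \<Rightarrow> nat) \<Rightarrow> (nat \<Rightarrow> tensor3) \<Rightarrow> nat \<Rightarrow> real mat" where
  "interface_le n r X k = mat (\<Prod>l=1..k. n l) (r k)
     (\<lambda>(i, j). slice_prod r X 1 k (multi_index n 1 i) $$ (0, j))"

definition interface_ge ::
  "nat \<Rightarrow> (nat \<Rightarrow> nat) \<Rightarrow> (nat \<Rightarrow> nat) \<Rightarrow> (nat \<Rightarrow> tensor3) \<Rightarrow> nat \<Rightarrow> real mat" where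
  "interface_ge d n r X k = mat (\<Prod>l=k..d. n l) (r (k - 1))
     (\<lambda>(i, j). (slice_prod r X k d (multi_index n k i))\<^sup>T $$ (0, j))"

lemma interface_le_0: "r 0 = 1 \<Longrightarrow> interface_le n r X 0 = 1\<^sub>m 1"
  by (auto simp: interface_le_def slice_prod_def)

lemma interface_ge_Suc: "r d = 1 \<Longrightarrow> interface_ge d n r X (d + 1) = 1\<^sub>m 1"
  by (auto simp: interface_ge_def slice_prod_def)

definition gram_L :: "(nat \<Rightarrow> nat) \<Rightarrow> (nat \<Rightarrow> nat) \<Rightarrow> (nat \<Rightarrow> tensor3) \<Rightarrow> nat \<Rightarrow> real mat" where
  "gram_L n r X k = (interface_le n r X k)\<^sup>T * interface_le n r X k"

definition gram_R ::
  "nat \<Rightarrow> (nat \<Rightarrow> nat) \<Rightarrow> (nat \<Rightarrow> nat) \<Rightarrow> (nat \<Rightarrow> tensor3) \<Rightarrow> nat \<Rightarrow> real mat" where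
  "gram_R d n r X k = (interface_ge d n r X k)\<^sup>T * interface_ge d n r X k"

definition block_A ::
  "nat \<Rightarrow> (nat \<Rightarrow> nat) \<Rightarrow> (nat \<Rightarrow> nat) \<Rightarrow> (nat \<Rightarrow> tensor3) \<Rightarrow> nat \<Rightarrow> real mat" where
  "block_A d n r X k = gram_R d n r X (k + 1) \<otimes>\<^sub>K gram_L n r X k"

definition block_B ::
  "nat \<Rightarrow> (nat \<Rightarrow> nat) \<Rightarrow> (nat \<Rightarrow> nat) \<Rightarrow> (nat \<Rightarrow> tensor3) \<Rightarrow> nat \<Rightarrow> real mat" where
  "block_B d n r X k = (- 1 / 2) \<cdot>\<^sub>m
     ((core_R n r X (k + 1) \<otimes>\<^sub>K gram_L n r X k) *
      (gram_R d n r X (k + 2) \<otimes>\<^sub>K core_L n r X (k + 1)))"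

(* block_matrix m s M is the square matrix with m x m blocks, block (k, l) being M k l of
   size s k x s l, for k, l = 1..m. *)

definition block_offset :: "(nat \<Rightarrow> nat) \<Rightarrow> nat \<Rightarrow> nat" where
  "block_offset s k = (\<Sum>l=1..<k. s l)"

definition block_of :: "(nat \<Rightarrow> nat) \<Rightarrow> nat \<Rightarrow> nat" where
  "block_of s i = (LEAST k. i < block_offset s (Suc k))"

definition block_matrix :: "nat \<Rightarrow> (nat \<Rightarrow> nat) \<Rightarrow> (nat \<Rightarrow> nat \<Rightarrow> real mat) \<Rightarrow> real mat" where
  "block_matrix m s M = mat (\<Sum>k=1..m. s k) (\<Sum>k=1..m. s k)
     (\<lambda>(i, j). M (block_of s i) (block_of s j) $$
        (i - block_offset s (block_of s i), j - block_offset s (block_of s j)))"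

lemma block_offset_Suc: "1 \<le> k \<Longrightarrow> block_offset s (Suc k) = block_offset s k + s k"
  by (simp add: block_offset_def)

lemma block_offset_mono: "k \<le> l \<Longrightarrow> block_offset s k \<le> block_offset s l"
  unfolding block_offset_def by (intro sum_mono2) auto

lemma block_of_offset:
  assumes "1 \<le> k" "a < s k"
  shows "block_of s (block_offset s k + a) = k"
  unfolding block_of_def
proof (rule Least_equality)
  show "block_offset s k + a < block_offset s (Suc k)"
    using assms by (simp add: block_offset_Suc)
next
  fix y assume y: "block_offset s k + a < block_offset s (Suc y)"
  show "k \<le> y"
  proof (rule ccontr)
    assume "\<not> k \<le> y"
    then show False using y block_offset_mono[of "Suc y" k s] by simp
  qed
qed

lemma block_offset_less:
  assumes "1 \<le> k" "k \<le> m" "a < s k"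
  shows "block_offset s k + a < (\<Sum>k=1..m. s k)"
proof -
  have "block_offset s k + a < block_offset s (Suc k)"
    using assms by (simp add: block_offset_Suc)
  also have "\<dots> \<le> block_offset s (Suc m)" using assms by (intro block_offset_mono) simp
  also have "\<dots> = (\<Sum>k=1..m. s k)" by (simp only: block_offset_def atLeastLessThanSuc_atLeastAtMost)
  finally show ?thesis .
qed

lemma block_matrix_index:
  assumes "1 \<le> k" "k \<le> m" "1 \<le> l" "l \<le> m" "a < s k" "b < s l"
  shows "block_matrix m s M $$ (block_offset s k + a, block_offset s l + b) = M k l $$ (a, b)"
  unfolding block_matrix_def
  using assms by (subst index_mat) (simp_all only: block_offset_less block_of_offset split_conv add_diff_cancel_left')

definition tridiag_block ::
  "nat \<Rightarrow> (nat \<Rightarrow> nat) \<Rightarrow> (nat \<Rightarrow> nat) \<Rightarrow> (nat \<Rightarrow> tensor3) \<Rightarrow> nat \<Rightarrow> nat \<Rightarrow> real mat" where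
  "tridiag_block d n r X k l =
     (if l = k then block_A d n r X k
      else if l = k + 1 then block_B d n r X k
      else if k = l + 1 then (block_B d n r X l)\<^sup>T
      else 0\<^sub>m ((r k)\<^sup>2) ((r l)\<^sup>2))"

definition tridiag_matrix ::
  "nat \<Rightarrow> (nat \<Rightarrow> nat) \<Rightarrow> (nat \<Rightarrow> nat) \<Rightarrow> (nat \<Rightarrow> tensor3) \<Rightarrow> real mat" where
  "tridiag_matrix d n r X = block_matrix (d - 1) (\<lambda>k. (r k)\<^sup>2) (tridiag_block d n r X)"

lemma tridiag_matrix_carrier:
  "tridiag_matrix d n r X \<in> carrier_mat (\<Sum>k=1..d - 1. (r k)\<^sup>2) (\<Sum>k=1..d - 1. (r k)\<^sup>2)"
  by (simp add: tridiag_matrix_def block_matrix_def)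

lemma block_A_carrier: "block_A d n r X k \<in> carrier_mat ((r k)\<^sup>2) ((r k)\<^sup>2)"
  by (intro carrier_matI) (simp_all add: block_A_def kron_def gram_L_def gram_R_def interface_le_def interface_ge_def
      power2_eq_square)

lemma block_B_carrier: "block_B d n r X k \<in> carrier_mat ((r k)\<^sup>2) ((r (k + 1))\<^sup>2)"
  by (intro carrier_matI) (simp_all add: block_B_def kron_def gram_L_def gram_R_def interface_le_def interface_ge_def
      core_L_def core_R_def left_unfolding_def right_unfolding_def power2_eq_square)

end

theory Submission
  imports Defs
begin

text \<open>
  Let \<open>E\<^sub>k = X\<^bsup>\<ge>k+1\<^esup> \<otimes> X\<^bsup>\<le>k\<^esup>\<close>, for \<open>k = 1, \<dots>, d - 1\<close>. This matrix sends the vectorisation of an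
  \<open>r\<^sub>k \<times> r\<^sub>k\<close> matrix \<open>D\<close> to the full tensor of size \<open>n\<^sub>1 \<times> \<dots> \<times> n\<^sub>d\<close> that the tensor train represents
  once \<open>D\<close> is inserted between the cores \<open>k\<close> and \<open>k + 1\<close> (\<open>insertion\<close>). All \<open>E\<^sub>k\<close> have the same
  codomain, and the blocks of the matrix are multiples of their mutual Gram matrices:
  \<open>A\<^sub>k = E\<^sub>k\<^sup>T E\<^sub>k\<close> (\<open>block_A_gram\<close>) and \<open>B\<^sub>k = - 1/2 E\<^sub>k\<^sup>T E\<^bsub>k+1\<^esub>\<close> (\<open>block_B_gram\<close>). The first identity
  is the mixed-product rule. The second holds because \<open>X\<^bsup>\<ge>k+1\<^esup>\<close> and \<open>X\<^bsup>\<le>k+1\<^esup>\<close> split off the core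
  \<open>k + 1\<close>, so that \<open>E\<^sub>k\<close> and \<open>E\<^bsub>k+1\<^esub>\<close> both factor through \<open>X\<^bsup>\<ge>k+2\<^esup> \<otimes> I \<otimes> X\<^bsup>\<le>k\<^esup>\<close>.

  For a block vector with parts \<open>x\<^sub>1, \<dots>, x\<^bsub>d-1\<^esub>\<close> put \<open>u\<^sub>k = E\<^sub>k x\<^sub>k\<close> and \<open>m = d - 1\<close>. The quadratic form
  of the matrix is then
  \<open>\<Sum>\<^sub>k \<parallel>u\<^sub>k\<parallel>\<^sup>2 - \<Sum>\<^sub>k \<langle>u\<^sub>k, u\<^bsub>k+1\<^esub>\<rangle> = 1/2 (\<parallel>u\<^sub>1\<parallel>\<^sup>2 + \<parallel>u\<^sub>m\<parallel>\<^sup>2 + \<Sum>\<^sub>k \<parallel>u\<^sub>k - u\<^bsub>k+1\<^esub>\<parallel>\<^sup>2)\<close>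
  (\<open>coupling_sum_of_squares\<close>, applied in each coordinate). It is nonnegative, and it vanishes only if
  \<open>u\<^sub>1 = 0\<close> and consecutive \<open>u\<^sub>k\<close> agree, so only if all \<open>u\<^sub>k\<close> are zero. The rank conditions make the
  interface matrices, and with them \<open>E\<^sub>k\<close>, injective, so then all \<open>x\<^sub>k\<close> are zero as well.

  Injectivity is expressed by the existence of a left inverse, a property that evidently passes to
  matrix products and, by the mixed-product rule, to Kronecker products.
\<close>

section \<open>Kronecker products\<close>

lemma dim_kron [simp]:
  "dim_row (A \<otimes>\<^sub>K B) = dim_row A * dim_row B"
  "dim_col (A \<otimes>\<^sub>K B) = dim_col A * dim_col B"
  by (simp_all add: kron_def)

lemma div_mod_less:
  fixes i m n :: nat
  assumes "i < m * n"
  shows "i div n < m" "i mod n < n"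
proof -
  have "n > 0" using assms by (cases n) auto
  then show "i div n < m" "i mod n < n"
    using assms by (auto simp: less_mult_imp_div_less)
qed

lemma kron_index:
  assumes "i < dim_row A * dim_row B" "j < dim_col A * dim_col B"
  shows "(A \<otimes>\<^sub>K B) $$ (i, j) =
    A $$ (i div dim_row B, j div dim_col B) * B $$ (i mod dim_row B, j mod dim_col B)"
  using assms by (simp add: kron_def)

text \<open>
  A Kronecker index \<open>k\<close> is the pair \<open>(k div n, k mod n)\<close>, so a sum over it is a double sum; this is how
  an entry of a matrix product with a Kronecker factor is expanded.
\<close>

lemma sum_div_mod:
  fixes f :: "nat \<Rightarrow> nat \<Rightarrow> 'a::comm_monoid_add"
  shows "(\<Sum>k<m * n. f (k div n) (k mod n)) = (\<Sum>i<m. \<Sum>j<n. f i j)"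
proof -
  have "(\<Sum>k<m * n. f (k div n) (k mod n)) =
      (\<Sum>i<m. \<Sum>k\<in>{i * n..<i * n + n}. f (k div n) (k mod n))"
    by (rule sum.nat_group [symmetric])
  also have "\<dots> = (\<Sum>i<m. \<Sum>j<n. f i j)"
  proof (rule sum.cong [OF refl])
    fix i
    have "(\<Sum>k\<in>{i * n..<i * n + n}. f (k div n) (k mod n)) =
        (\<Sum>j\<in>{0..<n}. f ((j + i * n) div n) ((j + i * n) mod n))"
      using sum.shift_bounds_nat_ivl [of "\<lambda>k. f (k div n) (k mod n)" 0 "i * n" n]
      by (simp add: add.commute)
    also have "\<dots> = (\<Sum>j<n. f i j)"
      by (rule sum.cong) auto
    finally show "(\<Sum>k\<in>{i * n..<i * n + n}. f (k div n) (k mod n)) = (\<Sum>j<n. f i j)" .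
  qed
  finally show ?thesis .
qed

lemma index_mult_mat_sum:
  assumes "i < dim_row A" "j < dim_col B" "dim_col A = dim_row B"
  shows "(A * B) $$ (i, j) = (\<Sum>k<dim_col A. A $$ (i, k) * B $$ (k, j))"
  using assms by (simp add: scalar_prod_def lessThan_atLeast0)

lemma kron_mult:
  assumes "dim_col A = dim_row C" "dim_col B = dim_row D"
  shows "(A \<otimes>\<^sub>K B) * (C \<otimes>\<^sub>K D) = (A * C) \<otimes>\<^sub>K (B * D)"
proof (rule eq_matI)
  fix i j
  assume "i < dim_row ((A * C) \<otimes>\<^sub>K (B * D))" and "j < dim_col ((A * C) \<otimes>\<^sub>K (B * D))"
  then have i: "i < dim_row A * dim_row B" and j: "j < dim_col C * dim_col D" by simp_all
  note ij = div_mod_less [OF i] div_mod_less [OF j]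
  let ?a = "\<lambda>k. A $$ (i div dim_row B, k) * C $$ (k, j div dim_col D)"
  let ?b = "\<lambda>k. B $$ (i mod dim_row B, k) * D $$ (k, j mod dim_col D)"
  have "((A \<otimes>\<^sub>K B) * (C \<otimes>\<^sub>K D)) $$ (i, j) =
      (\<Sum>k<dim_col A * dim_col B. (A \<otimes>\<^sub>K B) $$ (i, k) * (C \<otimes>\<^sub>K D) $$ (k, j))"
    using i j assms by (subst index_mult_mat_sum) simp_all
  also have "\<dots> = (\<Sum>k<dim_col A * dim_col B. ?a (k div dim_col B) * ?b (k mod dim_col B))"
    using i j assms by (intro sum.cong) (simp_all add: kron_index)
  also have "\<dots> = (\<Sum>k<dim_col A. \<Sum>l<dim_col B. ?a k * ?b l)"
    by (rule sum_div_mod [where f = "\<lambda>k l. ?a k * ?b l"])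
  also have "\<dots> = (\<Sum>k<dim_col A. ?a k) * (\<Sum>l<dim_col B. ?b l)"
    by (rule sum_product [symmetric])
  also have "\<dots> = ((A * C) \<otimes>\<^sub>K (B * D)) $$ (i, j)"
    using i j ij assms by (simp add: kron_index index_mult_mat_sum del: index_mult_mat(1))
  finally show "((A \<otimes>\<^sub>K B) * (C \<otimes>\<^sub>K D)) $$ (i, j) = ((A * C) \<otimes>\<^sub>K (B * D)) $$ (i, j)" .
qed simp_all

lemma kron_transpose: "(A \<otimes>\<^sub>K B)\<^sup>T = A\<^sup>T \<otimes>\<^sub>K B\<^sup>T"
  by (rule eq_matI) (auto simp: kron_index div_mod_less)

lemma kron_one: "1\<^sub>m m \<otimes>\<^sub>K 1\<^sub>m n = 1\<^sub>m (m * n)"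
proof (rule eq_matI)
  fix i j
  assume "i < dim_row (1\<^sub>m (m * n) :: real mat)" "j < dim_col (1\<^sub>m (m * n) :: real mat)"
  then have ij: "i < m * n" "j < m * n" by simp_all
  have "i = j \<longleftrightarrow> i div n = j div n \<and> i mod n = j mod n"
    by (metis div_mult_mod_eq)
  then show "(1\<^sub>m m \<otimes>\<^sub>K 1\<^sub>m n) $$ (i, j) = (1\<^sub>m (m * n) :: real mat) $$ (i, j)"
    using ij by (auto simp: kron_index div_mod_less)
qed simp_all

lemma kron_assoc: "(A \<otimes>\<^sub>K B) \<otimes>\<^sub>K C = A \<otimes>\<^sub>K (B \<otimes>\<^sub>K C)"
proof (rule eq_matI)
  fix i j
  assume "i < dim_row (A \<otimes>\<^sub>K (B \<otimes>\<^sub>K C))" "j < dim_col (A \<otimes>\<^sub>K (B \<otimes>\<^sub>K C))"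
  then have i: "i < dim_row A * dim_row B * dim_row C" and j: "j < dim_col A * dim_col B * dim_col C"
    by (simp_all add: mult.assoc)
  note i' = i [unfolded mult.assoc] and j' = j [unfolded mult.assoc]
  have dm: "k mod (p * q) div q = k div q mod p" "k mod (p * q) mod q = k mod q"
    "k div (p * q) = k div q div p" for k p q :: nat
    by (cases "q = 0"; simp add: mult.commute [of p q] mod_mult2_eq div_mult2_eq)+
  show "((A \<otimes>\<^sub>K B) \<otimes>\<^sub>K C) $$ (i, j) = (A \<otimes>\<^sub>K (B \<otimes>\<^sub>K C)) $$ (i, j)"
    using i j i' j' div_mod_less [OF i] div_mod_less [OF j] div_mod_less [OF i'] div_mod_less [OF j']
    by (simp add: kron_index dm)
qed (simp_all add: mult.assoc)

text \<open>
  Stated with dimension equations, associativity and the rule for transposes of products can be used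
  for rewriting without naming the dimensions.
\<close>

lemma mult_mat_assoc:
  fixes A B C :: "real mat"
  assumes "dim_col A = dim_row B" "dim_col B = dim_row C"
  shows "A * B * C = A * (B * C)"
  using assms by (intro assoc_mult_mat [of _ "dim_row A" "dim_col A" _ "dim_col B" _ "dim_col C"]) auto

lemma transpose_mult_dim:
  fixes A B :: "real mat"
  assumes "dim_col A = dim_row B"
  shows "(A * B)\<^sup>T = B\<^sup>T * A\<^sup>T"
  using assms by (intro transpose_mult [of _ "dim_row A" "dim_col A" _ "dim_col B"]) auto

section \<open>Full rank and left inverses\<close>

definition has_left_inverse :: "real mat \<Rightarrow> bool" where
  "has_left_inverse A \<longleftrightarrow> (\<exists>G. dim_col G = dim_row A \<and> G * A = 1\<^sub>m (dim_col A))"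

lemma left_inverse_one: "has_left_inverse (1\<^sub>m n)"
  unfolding has_left_inverse_def by (rule exI [of _ "1\<^sub>m n"]) simp

lemma left_inverse_mult:
  assumes "has_left_inverse A" "has_left_inverse B" "dim_col A = dim_row B"
  shows "has_left_inverse (A * B)"
proof -
  obtain G H where G: "dim_col G = dim_row A" "G * A = 1\<^sub>m (dim_col A)"
    and H: "dim_col H = dim_row B" "H * B = 1\<^sub>m (dim_col B)"
    using assms by (auto simp: has_left_inverse_def)
  have dG: "dim_row G = dim_col A"
    using arg_cong [OF G(2), of dim_row] by simp
  have "H * G * (A * B) = H * (G * A * B)"
    using G(1) H(1) dG assms(3) by (simp add: mult_mat_assoc)
  also have "\<dots> = 1\<^sub>m (dim_col B)"
    using G(2) H assms(3) by simp
  finally have "(H * G) * (A * B) = 1\<^sub>m (dim_col (A * B))" by simp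
  then show ?thesis
    unfolding has_left_inverse_def using G by (intro exI [of _ "H * G"]) simp
qed

lemma left_inverse_kron:
  assumes "has_left_inverse A" "has_left_inverse B"
  shows "has_left_inverse (A \<otimes>\<^sub>K B)"
proof -
  obtain G H where G: "dim_col G = dim_row A" "G * A = 1\<^sub>m (dim_col A)"
    and H: "dim_col H = dim_row B" "H * B = 1\<^sub>m (dim_col B)"
    using assms by (auto simp: has_left_inverse_def)
  have "(G \<otimes>\<^sub>K H) * (A \<otimes>\<^sub>K B) = 1\<^sub>m (dim_col (A \<otimes>\<^sub>K B))"
    using G H by (simp add: kron_mult kron_one)
  then show ?thesis
    unfolding has_left_inverse_def using G(1) H(1) by (intro exI [of _ "G \<otimes>\<^sub>K H"]) simp
qed

lemma left_inverse_kernel: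
  assumes "has_left_inverse A" "v \<in> carrier_vec (dim_col A)" "A *\<^sub>v v = 0\<^sub>v (dim_row A)"
  shows "v = 0\<^sub>v (dim_col A)"
proof -
  obtain G where G: "dim_col G = dim_row A" "G * A = 1\<^sub>m (dim_col A)"
    using assms by (auto simp: has_left_inverse_def)
  have dG: "dim_row G = dim_col A"
    using arg_cong [OF G(2), of dim_row] by simp
  have "v = (G * A) *\<^sub>v v" using G assms by simp
  also have "\<dots> = G *\<^sub>v (A *\<^sub>v v)"
    by (rule assoc_mult_mat_vec [of G "dim_col A" "dim_row A" A "dim_col A"])
      (use assms G dG in auto)
  also have "\<dots> = 0\<^sub>v (dim_col A)"
    using assms(3) G dG by (intro eq_vecI) (simp_all add: scalar_prod_def)
  finally show ?thesis .
qed

lemma real_scalar_prod_self_0: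
  fixes v :: "real vec"
  assumes "v \<bullet> v = 0"
  shows "v = 0\<^sub>v (dim_vec v)"
  using assms by (intro eq_vecI) (auto simp: scalar_prod_def sum_nonneg_eq_0_iff)

text \<open>
  If \<open>A\<close> is injective, then so is \<open>A\<^sup>T A\<close>, because \<open>A\<^sup>T A v = 0\<close> forces \<open>\<parallel>A v\<parallel>\<^sup>2 = 0\<close>. The latter is square,
  so it has an inverse \<open>H\<close>, and \<open>H A\<^sup>T\<close> is a left inverse of \<open>A\<close>.
\<close>

lemma left_inverseI_kernel:
  fixes A :: "real mat"
  assumes ker: "\<And>v. v \<in> carrier_vec (dim_col A) \<Longrightarrow> A *\<^sub>v v = 0\<^sub>v (dim_row A) \<Longrightarrow>
    v = 0\<^sub>v (dim_col A)"
  shows "has_left_inverse A"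
proof -
  let ?n = "dim_col A" and ?M = "A\<^sup>T * A"
  have M: "?M \<in> carrier_mat ?n ?n" by (intro carrier_matI) simp_all
  have "det ?M \<noteq> 0"
  proof
    assume "det ?M = 0"
    then obtain v where v: "v \<in> carrier_vec ?n" "v \<noteq> 0\<^sub>v ?n" "?M *\<^sub>v v = 0\<^sub>v ?n"
      using det_0_iff_vec_prod_zero_field [OF M] by auto
    have A: "A \<in> carrier_mat (dim_row A) ?n" by auto
    have "(A *\<^sub>v v) \<bullet> (A *\<^sub>v v) = (A\<^sup>T *\<^sub>v (A *\<^sub>v v)) \<bullet> v"
      using v by (intro transpose_vec_mult_scalar [OF A, symmetric] mult_mat_vec_carrier [OF A])
    also have "A\<^sup>T *\<^sub>v (A *\<^sub>v v) = ?M *\<^sub>v v"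
      by (rule assoc_mult_mat_vec [of _ ?n "dim_row A" _ ?n, symmetric]) (use v in auto)
    finally have "(A *\<^sub>v v) \<bullet> (A *\<^sub>v v) = 0" using v by simp
    then have "A *\<^sub>v v = 0\<^sub>v (dim_row A)" using real_scalar_prod_self_0 by fastforce
    then show False using ker v by auto
  qed
  then obtain H where H: "H \<in> carrier_mat ?n ?n" "H * ?M = 1\<^sub>m ?n"
    using det_non_zero_imp_unit [OF M, where b = "()"]
    by (auto simp: Units_def ring_mat_def)
  then have "H * A\<^sup>T * A = 1\<^sub>m ?n" by (simp add: mult_mat_assoc)
  then show ?thesis unfolding has_left_inverse_def by (intro exI [of _ "H * A\<^sup>T"]) simp
qed

lemma left_inverse_full_col_rank:
  assumes "mat_rank A = dim_col A"
  shows "has_left_inverse A"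
proof (rule left_inverseI_kernel)
  fix v
  assume v: "v \<in> carrier_vec (dim_col A)" "A *\<^sub>v v = 0\<^sub>v (dim_row A)"
  interpret vec_space "TYPE(real)" "dim_row A" .
  have A: "A \<in> carrier_mat (dim_row A) (dim_col A)" by auto
  have rk: "rank A = dim_col A" using assms by (simp add: mat_rank_def)
  \<comment> \<open>The rank depends only on the set of columns, so full column rank first has to exclude repetitions.\<close>
  obtain S where S: "maximal S (\<lambda>T. T \<subseteq> set (cols A) \<and> lin_indpt T)"
    using maximal_exists_superset [of "set (cols A)" "\<lambda>T. T \<subseteq> set (cols A) \<and> lin_indpt T" "{}"]
      finite_lin_indpt2 [of "{}"] by auto
  then have "dim_col A = card S" using rank_card_indpt [OF A S] rk by simp
  also have "card S \<le> card (set (cols A))"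
    using S by (intro card_mono) (auto simp: maximal_def)
  finally have "card (set (cols A)) = length (cols A)"
    using card_length [of "cols A"] by simp
  then have dist: "distinct (cols A)" by (rule card_distinct)
  then show "v = 0\<^sub>v (dim_col A)"
    using lin_depI [OF A v(1) _ v(2) dist] full_rank_lin_indpt [OF A rk dist] by blast
qed

text \<open>
  Full row rank yields as many independent columns as there are rows. They form an invertible square matrix \<open>C\<close>, and \<open>A\<^sup>T v = 0\<close> implies \<open>C\<^sup>T v = 0\<close>.
\<close>

lemma left_inverse_full_row_rank:
  assumes "mat_rank A = dim_row A"
  shows "has_left_inverse A\<^sup>T"
proof (rule left_inverseI_kernel)
  fix v
  let ?n = "dim_row A"
  assume "v \<in> carrier_vec (dim_col A\<^sup>T)" "A\<^sup>T *\<^sub>v v = 0\<^sub>v (dim_row A\<^sup>T)"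
  then have v: "v \<in> carrier_vec ?n" "A\<^sup>T *\<^sub>v v = 0\<^sub>v (dim_col A)" by simp_all
  interpret vec_space "TYPE(real)" ?n .
  have A: "A \<in> carrier_mat ?n (dim_col A)" by auto
  have rk: "rank A = ?n" using assms by (simp add: mat_rank_def)
  obtain S where S: "maximal S (\<lambda>T. T \<subseteq> set (cols A) \<and> lin_indpt T)" "finite S"
    using maximal_exists_superset [of "set (cols A)" "\<lambda>T. T \<subseteq> set (cols A) \<and> lin_indpt T" "{}"]
      finite_lin_indpt2 [of "{}"] by auto
  then have card: "card S = ?n" using rank_card_indpt [OF A S(1)] rk by simp
  obtain cs where cs: "set cs = S" "distinct cs" using finite_distinct_list [OF S(2)] by auto
  have S': "S \<subseteq> set (cols A)" "lin_indpt S" using S(1) by (auto simp: maximal_def)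
  define C where "C = mat_of_cols ?n cs"
  have len: "length cs = ?n" using card cs distinct_card by fastforce
  have C: "C \<in> carrier_mat ?n ?n" using len mat_of_cols_carrier(1) [of ?n cs] by (simp only: C_def)
  have colsC: "cols C = cs"
    unfolding C_def using S' cs cols_dim [of A] by (intro cols_mat_of_cols) blast
  have "rank C = ?n"
    using lin_indpt_full_rank [OF C] colsC cs S' by simp
  then have "det C \<noteq> 0" using det_rank_iff [OF C] by simp
  then have "det C\<^sup>T \<noteq> 0" using det_transpose [OF C] by simp
  moreover have "C\<^sup>T *\<^sub>v v = 0\<^sub>v ?n"
  proof (rule eq_vecI)
    fix i assume "i < dim_vec (0\<^sub>v ?n :: real vec)"
    then have i: "i < ?n" by simp
    have "col C i \<in> set (cols A)"
      using i C S' cs colsC cols_nth [of i C] len by (metis carrier_matD(2) nth_mem subsetD)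
    then obtain j where j: "j < dim_col A" "col C i = col A j"
      by (auto simp: cols_def)
    have "(C\<^sup>T *\<^sub>v v) $ i = (A\<^sup>T *\<^sub>v v) $ j" using i j C by simp
    then show "(C\<^sup>T *\<^sub>v v) $ i = 0\<^sub>v ?n $ i" using v i j by simp
  qed (use C in simp)
  ultimately show "v = 0\<^sub>v (dim_col A\<^sup>T)"
    using det_0_iff_vec_prod_zero_field [of "C\<^sup>T" ?n] C v by auto
qed

section \<open>Recursion for the interface matrices\<close>

lemma slice_prod_empty: "slice_prod r X (Suc m) m f = 1\<^sub>m (r m)"
  by (simp add: slice_prod_def)

lemma slice_prod_Cons:
  "a \<le> m \<Longrightarrow> slice_prod r X a m f = slice r X a (f a) * slice_prod r X (Suc a) m f"
  unfolding slice_prod_def by (subst upt_conv_Cons) simp_all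

lemma slice_prod_carrier:
  assumes "a \<le> Suc m"
  shows "slice_prod r X a m f \<in> carrier_mat (r (a - 1)) (r m)"
  using assms
proof (induction a rule: inc_induct)
  case base
  show ?case by (simp add: slice_prod_empty)
next
  case (step a)
  then show ?case
    by (auto simp: slice_prod_Cons slice_def intro!: mult_carrier_mat)
qed

lemma slice_prod_Suc:
  assumes "a \<le> Suc m"
  shows "slice_prod r X a (Suc m) f = slice_prod r X a m f * slice r X (Suc m) (f (Suc m))"
  using assms
proof (induction a rule: inc_induct)
  case base
  have "slice r X (Suc m) (f (Suc m)) \<in> carrier_mat (r m) (r (Suc m))" by (simp add: slice_def)
  then show ?case by (simp add: slice_prod_Cons slice_prod_empty)
next
  case (step a)
  then show ?case
    using slice_prod_carrier [of "Suc a" m r X f]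
    by (simp add: slice_prod_Cons mult_mat_assoc slice_def)
qed

lemma slice_prod_cong:
  assumes "\<And>j. a \<le> j \<Longrightarrow> j \<le> m \<Longrightarrow> f j = g j"
  shows "slice_prod r X a m f = slice_prod r X a m g"
proof -
  have "map (\<lambda>j. slice r X j (f j)) [a..<Suc m] = map (\<lambda>j. slice r X j (g j)) [a..<Suc m]"
    using assms by (intro map_cong) auto
  then show ?thesis by (simp only: slice_prod_def)
qed

text \<open>
  In the linear position \<open>i\<close> of \<open>(i\<^sub>1, \<dots>, i\<^bsub>k+1\<^esub>)\<close> the last component varies slowest. With
  \<open>N = n\<^sub>1 \<cdots> n\<^sub>k\<close> it is \<open>i div N\<close>, and \<open>i mod N\<close> is the position of \<open>(i\<^sub>1, \<dots>, i\<^sub>k)\<close>. Hence the identity is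
  the left factor of the Kronecker product.
\<close>

lemma interface_le_Suc:
  assumes "r 0 = 1"
  shows "interface_le n r X (Suc k) =
    (1\<^sub>m (n (Suc k)) \<otimes>\<^sub>K interface_le n r X k) * core_L n r X (Suc k)"
proof (rule eq_matI)
  let ?P = "interface_le n r X k" and ?N = "\<Prod>l=1..k. n l" and ?n = "n (Suc k)"
  let ?rhs = "(1\<^sub>m ?n \<otimes>\<^sub>K ?P) * core_L n r X (Suc k)"
  have dP: "dim_row ?P = ?N" "dim_col ?P = r k" by (simp_all add: interface_le_def)
  have dL: "dim_row (core_L n r X (Suc k)) = r k * ?n"
    "dim_col (core_L n r X (Suc k)) = r (Suc k)"
    by (simp_all add: core_L_def left_unfolding_def)
  fix i j
  assume "i < dim_row ?rhs" "j < dim_col ?rhs"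
  then have i: "i < ?n * ?N" and j: "j < r (Suc k)" using dP dL by simp_all
  note ij = div_mod_less [OF i]
  let ?f = "multi_index n 1 i" and ?g = "multi_index n 1 (i mod ?N)"
  have fSuc: "?f (Suc k) = i div ?N"
    using ij by (simp add: multi_index_def atLeastLessThanSuc_atLeastAtMost)
  have fg: "?f l = ?g l" if l: "1 \<le> l" "l \<le> k" for l
  proof -
    let ?Pl = "\<Prod>m=1..<l. n m"
    have "prod n {1..<Suc l} dvd prod n {1..<Suc k}"
      using l by (intro prod_dvd_prod_subset) auto
    then obtain c where "prod n {1..<Suc k} = prod n {1..<Suc l} * c" by (rule dvdE)
    then have c: "?N = ?Pl * (n l * c)"
      using l by (simp only: atLeastLessThanSuc_atLeastAtMost [symmetric] prod.atLeastLessThan_Suc mult.assoc)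
    have "x mod (p * q) div p = x div p mod q" for x p q :: nat
      by (cases "p = 0") (simp_all add: mod_mult2_eq)
    then have "i mod ?N div ?Pl = i div ?Pl mod (n l * c)" by (simp only: c)
    then show ?thesis by (simp add: multi_index_def mod_mod_cancel)
  qed
  have "interface_le n r X (Suc k) $$ (i, j) = slice_prod r X 1 (Suc k) ?f $$ (0, j)"
    using i j by (simp add: interface_le_def mult.commute)
  also have "\<dots> = (\<Sum>t<r k. slice_prod r X 1 k ?f $$ (0, t) * X (Suc k) t (i div ?N) j)"
    using slice_prod_carrier [of 1 k r X ?f] j assms
    by (simp add: slice_prod_Suc fSuc [unfolded One_nat_def] index_mult_mat_sum slice_def del: index_mult_mat(1))
  also have "\<dots> = (\<Sum>t<r k. ?P $$ (i mod ?N, t) * X (Suc k) t (i div ?N) j)"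
    using ij slice_prod_cong [of 1 k ?f ?g r X] fg
    by (intro sum.cong) (simp_all add: interface_le_def)
  also have "\<dots> = (\<Sum>b<?n. if i div ?N = b
      then \<Sum>t<r k. ?P $$ (i mod ?N, t) * X (Suc k) t b j else 0)"
    using ij by simp
  also have "\<dots> = (\<Sum>b<?n. \<Sum>t<r k.
      (if i div ?N = b then 1 else 0) * ?P $$ (i mod ?N, t) * X (Suc k) t b j)"
    by (intro sum.cong) auto
  also have "\<dots> = (\<Sum>s<?n * r k. (if i div ?N = s div r k then 1 else 0) *
      ?P $$ (i mod ?N, s mod r k) * X (Suc k) (s mod r k) (s div r k) j)"
    by (rule sum_div_mod [symmetric])
  also have "\<dots> = (\<Sum>s<?n * r k.
      (1\<^sub>m ?n \<otimes>\<^sub>K ?P) $$ (i, s) * core_L n r X (Suc k) $$ (s, j))"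
    using i j ij dP div_mod_less(1)
    by (intro sum.cong) (simp_all add: kron_index core_L_def left_unfolding_def mult.commute [of "r k"])
  also have "\<dots> = ?rhs $$ (i, j)"
    using i j dP dL by (subst index_mult_mat_sum) (simp_all add: mult.commute)
  finally show "interface_le n r X (Suc k) $$ (i, j) = ?rhs $$ (i, j)" .
qed (simp_all add: interface_le_def core_L_def left_unfolding_def mult.commute)

text \<open>
  The mirror image of \<open>interface_le_Suc\<close>: the core that is split off now carries the fastest component
  \<open>i mod n\<^sub>k\<close>, and \<open>i div n\<^sub>k\<close> is the position of the remaining ones, so the identity is the right factor.
\<close>

lemma interface_ge_step:
  assumes "r d = 1" "1 \<le> k" "k \<le> d"
  shows "interface_ge d n r X k =
    (interface_ge d n r X (Suc k) \<otimes>\<^sub>K 1\<^sub>m (n k)) * (core_R n r X k)\<^sup>T"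
proof (rule eq_matI)
  let ?Q = "interface_ge d n r X (Suc k)" and ?N = "\<Prod>l=Suc k..d. n l" and ?n = "n k"
  let ?rhs = "(?Q \<otimes>\<^sub>K 1\<^sub>m ?n) * (core_R n r X k)\<^sup>T"
  have dQ: "dim_row ?Q = ?N" "dim_col ?Q = r k" by (simp_all add: interface_ge_def)
  have dR: "dim_col (core_R n r X k) = ?n * r k" "dim_row (core_R n r X k) = r (k - 1)"
    by (simp_all add: core_R_def right_unfolding_def)
  have N: "(\<Prod>l=k..d. n l) = ?N * ?n"
    using assms by (simp add: prod.atLeast_Suc_atMost)
  show "dim_row (interface_ge d n r X k) = dim_row ?rhs"
    "dim_col (interface_ge d n r X k) = dim_col ?rhs"
    using dQ dR N by (simp_all add: interface_ge_def)
  fix i j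
  assume "i < dim_row ?rhs" "j < dim_col ?rhs"
  then have i: "i < ?N * ?n" and j: "j < r (k - 1)" using dQ dR by simp_all
  note ij = div_mod_less [OF i]
  let ?f = "multi_index n k i" and ?g = "multi_index n (Suc k) (i div ?n)"
  have fk: "?f k = i mod ?n" by (simp add: multi_index_def)
  have fg: "?f l = ?g l" if l: "Suc k \<le> l" "l \<le> d" for l
  proof -
    have "(\<Prod>m=k..<l. n m) = ?n * (\<Prod>m=Suc k..<l. n m)"
      using l by (simp add: prod.atLeast_Suc_lessThan)
    then show ?thesis by (simp add: multi_index_def div_mult2_eq)
  qed
  have "interface_ge d n r X k $$ (i, j) = slice_prod r X k d ?f $$ (j, 0)"
    using i j N slice_prod_carrier [of k d r X ?f] assms by (simp add: interface_ge_def)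
  also have "\<dots> = (\<Sum>t<r k. X k j (i mod ?n) t * slice_prod r X (Suc k) d ?f $$ (t, 0))"
    using slice_prod_carrier [of "Suc k" d r X ?f] j assms
    by (simp add: slice_prod_Cons fk index_mult_mat_sum slice_def del: index_mult_mat(1))
  also have "\<dots> = (\<Sum>t<r k. X k j (i mod ?n) t * ?Q $$ (i div ?n, t))"
    using ij slice_prod_cong [of "Suc k" d ?f ?g r X] fg slice_prod_carrier [of "Suc k" d r X ?g] assms
    by (intro sum.cong) (simp_all add: interface_ge_def)
  also have "\<dots> = (\<Sum>t<r k. \<Sum>b<?n. if i mod ?n = b then ?Q $$ (i div ?n, t) * X k j b t else 0)"
    using ij by (intro sum.cong) simp_all
  also have "\<dots> = (\<Sum>t<r k. \<Sum>b<?n.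
      ?Q $$ (i div ?n, t) * (if i mod ?n = b then 1 else 0) * X k j b t)"
    by (intro sum.cong) auto
  also have "\<dots> = (\<Sum>s<r k * ?n. ?Q $$ (i div ?n, s div ?n) *
      (if i mod ?n = s mod ?n then 1 else 0) * X k j (s mod ?n) (s div ?n))"
    by (rule sum_div_mod [symmetric])
  also have "\<dots> = (\<Sum>s<r k * ?n. (?Q \<otimes>\<^sub>K 1\<^sub>m ?n) $$ (i, s) * (core_R n r X k)\<^sup>T $$ (s, j))"
    using i j ij dQ dR div_mod_less
    by (intro sum.cong) (simp_all add: kron_index core_R_def right_unfolding_def mult.commute [of ?n])
  also have "\<dots> = ?rhs $$ (i, j)"
    using i j dQ dR by (subst index_mult_mat_sum) (simp_all add: mult.commute)
  finally show "interface_ge d n r X k $$ (i, j) = ?rhs $$ (i, j)" .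
qed

section \<open>The blocks as Gram matrices of the insertion maps\<close>

text \<open>
  The Kronecker order is the one for which vectorisation with the first index varying fastest turns
  \<open>D \<mapsto> X\<^bsup>\<le>k\<^esup> D (X\<^bsup>\<ge>k+1\<^esup>)\<^sup>T\<close> into this matrix.
\<close>

definition insertion ::
  "nat \<Rightarrow> (nat \<Rightarrow> nat) \<Rightarrow> (nat \<Rightarrow> nat) \<Rightarrow> (nat \<Rightarrow> tensor3) \<Rightarrow> nat \<Rightarrow> real mat" where
  "insertion d n r X k = interface_ge d n r X (k + 1) \<otimes>\<^sub>K interface_le n r X k"

lemma insertion_carrier:
  assumes "k \<le> d"
  shows "insertion d n r X k \<in> carrier_mat (\<Prod>l=1..d. n l) ((r k)\<^sup>2)"
proof -
  have "(\<Prod>l=1..k. n l) * (\<Prod>l=k + 1..d. n l) = (\<Prod>l=1..d. n l)"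
    using assms prod.ub_add_nat [of 1 k n "d - k"] by simp
  then show ?thesis
    by (intro carrier_matI)
      (simp_all add: insertion_def interface_ge_def interface_le_def power2_eq_square mult.commute)
qed

lemma left_inverse_interface_le:
  assumes X: "X \<in> total_space d n r" and "r 0 = 1" and "k \<le> d"
  shows "has_left_inverse (interface_le n r X k)"
  using \<open>k \<le> d\<close>
proof (induction k)
  case 0
  then show ?case using assms by (simp add: interface_le_0 left_inverse_one)
next
  case (Suc k)
  have "mat_rank (core_L n r X (Suc k)) = r (Suc k)"
    using X Suc.prems by (simp add: total_space_def)
  then have "has_left_inverse (core_L n r X (Suc k))"
    by (intro left_inverse_full_col_rank) (simp add: core_L_def left_unfolding_def)
  then show ?case
    unfolding interface_le_Suc [of r, OF \<open>r 0 = 1\<close>] using Suc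
    by (intro left_inverse_mult left_inverse_kron left_inverse_one)
      (simp_all add: interface_le_def core_L_def left_unfolding_def)
qed

lemma left_inverse_interface_ge:
  assumes X: "X \<in> total_space d n r" and "r d = 1" and "1 \<le> k" "k \<le> Suc d"
  shows "has_left_inverse (interface_ge d n r X k)"
  using \<open>k \<le> Suc d\<close> \<open>1 \<le> k\<close>
proof (induction k rule: inc_induct)
  case base
  then show ?case
    using assms interface_ge_Suc [of r d n X] by (simp add: left_inverse_one)
next
  case (step k)
  have "mat_rank (core_R n r X k) = r (k - 1)"
    using X step by (simp add: total_space_def)
  then have "has_left_inverse (core_R n r X k)\<^sup>T"
    by (intro left_inverse_full_row_rank) (simp add: core_R_def right_unfolding_def)
  moreover have "interface_ge d n r X k =
      (interface_ge d n r X (Suc k) \<otimes>\<^sub>K 1\<^sub>m (n k)) * (core_R n r X k)\<^sup>T"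
    using assms step by (intro interface_ge_step) simp_all
  ultimately show ?case
    using step
    by (simp add: left_inverse_mult left_inverse_kron left_inverse_one
      interface_ge_def core_R_def right_unfolding_def mult.commute)
qed

lemma block_A_gram: "block_A d n r X k = (insertion d n r X k)\<^sup>T * insertion d n r X k"
  by (simp add: block_A_def insertion_def gram_L_def gram_R_def kron_transpose kron_mult)

text \<open>
  Write \<open>P = X\<^bsup>\<le>k\<^esup>\<close>, \<open>Q = X\<^bsup>\<ge>k+2\<^esup>\<close> and let \<open>L\<close>, \<open>R\<close> be the unfoldings of the core \<open>k + 1\<close>. Splitting off that
  core gives \<open>E\<^sub>k = W (R\<^sup>T \<otimes> I)\<close> and \<open>E\<^bsub>k+1\<^esub> = W (I \<otimes> L)\<close> with the same \<open>W = Q \<otimes> I \<otimes> P\<close>. Therefore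
  \<open>E\<^sub>k\<^sup>T E\<^bsub>k+1\<^esub> = (R \<otimes> I) (Q\<^sup>T Q \<otimes> I \<otimes> P\<^sup>T P) (I \<otimes> L)\<close>, and the middle factor \<open>V\<close> is
  \<open>(I \<otimes> P\<^sup>T P) (Q\<^sup>T Q \<otimes> I)\<close>, whose two factors merge with \<open>R \<otimes> I\<close> and \<open>I \<otimes> L\<close>.
\<close>

lemma block_B_gram:
  assumes "r 0 = 1" "r d = 1" "k + 2 \<le> d"
  shows "block_B d n r X k =
    (- 1 / 2) \<cdot>\<^sub>m ((insertion d n r X k)\<^sup>T * insertion d n r X (k + 1))"
proof -
  define P where "P = interface_le n r X k"
  define Q where "Q = interface_ge d n r X (k + 2)"
  define L where "L = core_L n r X (k + 1)"
  define R where "R = core_R n r X (k + 1)"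
  define m where "m = n (k + 1)"
  have dims [simp]: "dim_col P = r k" "dim_col Q = r (k + 1)"
    "dim_row L = r k * m" "dim_col L = r (k + 1)" "dim_row R = r k" "dim_col R = m * r (k + 1)"
    by (simp_all add: P_def Q_def L_def R_def m_def interface_le_def interface_ge_def
      core_L_def left_unfolding_def core_R_def right_unfolding_def)
  define W where "W = Q \<otimes>\<^sub>K (1\<^sub>m m \<otimes>\<^sub>K P)"
  define V where "V = (Q\<^sup>T * Q) \<otimes>\<^sub>K (1\<^sub>m m \<otimes>\<^sub>K (P\<^sup>T * P))"
  have W: "dim_col W = r (k + 1) * (m * r k)" by (simp add: W_def)
  have V: "dim_col V = r (k + 1) * (m * r k)" "dim_row V = r (k + 1) * (m * r k)"
    by (simp_all add: V_def)
  have WW: "W\<^sup>T * W = V" by (simp add: W_def V_def kron_transpose kron_mult)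
  have E: "insertion d n r X k = W * (R\<^sup>T \<otimes>\<^sub>K 1\<^sub>m (r k))"
  proof -
    have "interface_ge d n r X (k + 1) = (Q \<otimes>\<^sub>K 1\<^sub>m m) * R\<^sup>T"
      using assms interface_ge_step [of r d "k + 1" n X] by (simp add: Q_def R_def m_def)
    then show ?thesis
      unfolding insertion_def P_def [symmetric]
      by (simp add: W_def kron_assoc [symmetric] kron_mult mult.commute)
  qed
  have E': "insertion d n r X (k + 1) = W * (1\<^sub>m (r (k + 1)) \<otimes>\<^sub>K L)"
  proof -
    have "interface_le n r X (k + 1) = (1\<^sub>m m \<otimes>\<^sub>K P) * L"
      using assms interface_le_Suc [of r n X k] by (simp add: P_def L_def m_def)
    moreover have "interface_ge d n r X (k + 1 + 1) = Q" by (simp add: Q_def)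
    ultimately show ?thesis
      unfolding insertion_def by (simp add: W_def kron_mult mult.commute)
  qed
  have "(insertion d n r X k)\<^sup>T * insertion d n r X (k + 1) =
      ((R \<otimes>\<^sub>K 1\<^sub>m (r k)) * W\<^sup>T) * (W * (1\<^sub>m (r (k + 1)) \<otimes>\<^sub>K L))"
    unfolding E E' by (simp add: transpose_mult_dim kron_transpose W mult.commute mult.left_commute)
  also have "\<dots> = (R \<otimes>\<^sub>K 1\<^sub>m (r k)) * (V * (1\<^sub>m (r (k + 1)) \<otimes>\<^sub>K L))"
    by (simp add: mult_mat_assoc WW [symmetric] W mult.commute mult.left_commute)
  also have "V = (1\<^sub>m (m * r (k + 1)) \<otimes>\<^sub>K (P\<^sup>T * P)) * ((Q\<^sup>T * Q) \<otimes>\<^sub>K 1\<^sub>m (r k * m))"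
  proof -
    have "1\<^sub>m (m * r (k + 1)) \<otimes>\<^sub>K (P\<^sup>T * P) = 1\<^sub>m (r (k + 1)) \<otimes>\<^sub>K (1\<^sub>m m \<otimes>\<^sub>K (P\<^sup>T * P))"
      by (simp add: kron_one kron_assoc [symmetric] mult.commute)
    moreover have "1\<^sub>m (r k * m) = 1\<^sub>m m \<otimes>\<^sub>K (1\<^sub>m (r k) :: real mat)"
      by (simp add: kron_one mult.commute)
    ultimately show ?thesis by (simp add: V_def kron_mult)
  qed
  also have "(R \<otimes>\<^sub>K 1\<^sub>m (r k)) * ((1\<^sub>m (m * r (k + 1)) \<otimes>\<^sub>K (P\<^sup>T * P)) *
        ((Q\<^sup>T * Q) \<otimes>\<^sub>K 1\<^sub>m (r k * m)) * (1\<^sub>m (r (k + 1)) \<otimes>\<^sub>K L)) =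
      ((R \<otimes>\<^sub>K 1\<^sub>m (r k)) * (1\<^sub>m (m * r (k + 1)) \<otimes>\<^sub>K (P\<^sup>T * P))) *
      (((Q\<^sup>T * Q) \<otimes>\<^sub>K 1\<^sub>m (r k * m)) * (1\<^sub>m (r (k + 1)) \<otimes>\<^sub>K L))"
    by (simp add: mult_mat_assoc mult.commute mult.left_commute)
  also have "\<dots> = (R \<otimes>\<^sub>K (P\<^sup>T * P)) * ((Q\<^sup>T * Q) \<otimes>\<^sub>K L)"
    by (simp add: kron_mult)
  finally show ?thesis
    by (simp add: block_B_def gram_L_def gram_R_def P_def Q_def L_def R_def)
qed

section \<open>The scalar quadratic form\<close>

text \<open>
  The coefficients that turn \<open>E\<^sub>k\<^sup>T E\<^sub>l\<close> into the block \<open>(k, l)\<close>. They form half of the matrix of the discrete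
  Laplacian with Dirichlet boundary conditions.
\<close>

definition coupling :: "nat \<Rightarrow> nat \<Rightarrow> real" where
  "coupling k l = (if l = k then 1 else if l = k + 1 \<or> k = l + 1 then - 1 / 2 else 0)"

lemma coupling_commute: "coupling k l = coupling l k"
  by (auto simp: coupling_def)

lemma coupling_sum_last:
  assumes "1 \<le> m"
  shows "(\<Sum>k=1..m. coupling k (Suc m) * w k) = - w m / 2"
proof -
  have "(\<Sum>k=1..m. coupling k (Suc m) * w k) = (\<Sum>k=1..m. if k = m then - w m / 2 else 0)"
    by (intro sum.cong) (auto simp: coupling_def)
  then show ?thesis using assms by simp
qed

text \<open>
  The boundary terms \<open>(w 1)\<^sup>2\<close> and \<open>(w m)\<^sup>2\<close> remain because an end point occurs in only one difference,
  while an interior point occurs in two. For \<open>m = 1\<close> they coincide and both count.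
\<close>

lemma coupling_sum_of_squares:
  assumes "1 \<le> m"
  shows "2 * (\<Sum>k=1..m. \<Sum>l=1..m. coupling k l * (w k * w l)) =
    (w 1)\<^sup>2 + (w m)\<^sup>2 + (\<Sum>k=1..<m. (w k - w (Suc k))\<^sup>2)"
  using assms
proof (induction m rule: dec_induct)
  case base
  show ?case by (simp add: coupling_def power2_eq_square)
next
  case (step m)
  let ?Q = "\<lambda>m. \<Sum>k=1..m. \<Sum>l=1..m. coupling k l * (w k * w l)"
  have last: "(\<Sum>k=1..m. coupling k (Suc m) * (w k * w (Suc m))) = - w m / 2 * w (Suc m)"
    using coupling_sum_last [OF step.hyps(1), of w, symmetric]
    by (simp add: sum_distrib_right mult.assoc)
  have row: "(\<Sum>l=1..m. coupling (Suc m) l * (w (Suc m) * w l)) = - w m / 2 * w (Suc m)"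
    unfolding last [symmetric]
    by (rule sum.cong) (simp_all add: coupling_def)
  have diag: "coupling (Suc m) (Suc m) * (w (Suc m) * w (Suc m)) = (w (Suc m))\<^sup>2"
    by (simp add: coupling_def power2_eq_square)
  have "?Q (Suc m) = ?Q m + (\<Sum>k=1..m. coupling k (Suc m) * (w k * w (Suc m))) +
      (\<Sum>l=1..m. coupling (Suc m) l * (w (Suc m) * w l)) +
      coupling (Suc m) (Suc m) * (w (Suc m) * w (Suc m))"
    by (simp add: sum.distrib)
  then have "2 * ?Q (Suc m) = 2 * ?Q m - 2 * w m * w (Suc m) + 2 * (w (Suc m))\<^sup>2"
    unfolding last row diag by simp
  also have "\<dots> = (w 1)\<^sup>2 + (w (Suc m))\<^sup>2 + ((\<Sum>k=1..<m. (w k - w (Suc k))\<^sup>2) + (w m - w (Suc m))\<^sup>2)"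
    unfolding step.IH by (simp add: power2_diff)
  finally show ?case using step.hyps by simp
qed

lemma coupling_pos:
  assumes "k \<in> {1..m}" "w k \<noteq> 0"
  shows "(\<Sum>k=1..m. \<Sum>l=1..m. coupling k l * (w k * w l)) > 0"
proof (rule ccontr)
  assume "\<not> ?thesis"
  moreover have "1 \<le> m" using assms by auto
  note sos = coupling_sum_of_squares [OF this, of w]
  have nn: "(\<Sum>k=1..<m. (w k - w (Suc k))\<^sup>2) \<ge> 0" by (rule sum_nonneg) simp
  ultimately have "(w 1)\<^sup>2 \<le> 0" "(\<Sum>k=1..<m. (w k - w (Suc k))\<^sup>2) \<le> 0"
    using sos zero_le_power2 [of "w 1"] zero_le_power2 [of "w m"] by linarith+
  then have w1: "w 1 = 0" and "(\<Sum>k=1..<m. (w k - w (Suc k))\<^sup>2) = 0"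
    using nn by auto
  then have step: "w (Suc l) = w l" if "l \<in> {1..<m}" for l
    using that by (simp add: sum_nonneg_eq_0_iff)
  have "1 \<le> k" "k \<le> m" using assms by auto
  then have "w k = 0"
    by (induction k rule: dec_induct) (use w1 step in auto)
  with assms show False by simp
qed

section \<open>Block matrices\<close>

lemma sum_blocks:
  fixes f :: "nat \<Rightarrow> 'a::comm_monoid_add"
  shows "(\<Sum>i<(\<Sum>k=1..m. s k). f i) = (\<Sum>k=1..m. \<Sum>a<s k. f (block_offset s k + a))"
proof (induction m)
  case (Suc m)
  have off: "block_offset s (Suc m) = (\<Sum>k=1..m. s k)"
    by (simp only: block_offset_def atLeastLessThanSuc_atLeastAtMost)
  have "(\<Sum>i<p + q. f i) = (\<Sum>i<p. f i) + (\<Sum>a<q. f (p + a))" for p q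
    by (induction q) (simp_all add: add.assoc)
  then show ?case using Suc off by simp
qed simp

lemma block_position:
  assumes "i < (\<Sum>k=1..m. s k)"
  obtains k a where "1 \<le> k" "k \<le> m" "a < s k" "i = block_offset s k + a"
proof -
  have "\<exists>k a. 1 \<le> k \<and> k \<le> m \<and> a < s k \<and> i = block_offset s k + a"
    using assms
  proof (induction m)
    case (Suc m)
    have off: "block_offset s (Suc m) = (\<Sum>k=1..m. s k)"
      by (simp only: block_offset_def atLeastLessThanSuc_atLeastAtMost)
    show ?case
    proof (cases "i < (\<Sum>k=1..m. s k)")
      case True
      then show ?thesis using Suc.IH by (meson le_SucI)
    next
      case False
      then have "i = block_offset s (Suc m) + (i - block_offset s (Suc m))"
        "i - block_offset s (Suc m) < s (Suc m)" using Suc.prems off by auto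
      then show ?thesis by (metis le_add1 le_refl plus_1_eq_Suc)
    qed
  qed simp
  then show ?thesis using that by blast
qed

lemma bilinear_form_sum:
  assumes "x \<in> carrier_vec (dim_row A)" "y \<in> carrier_vec (dim_col A)"
  shows "x \<bullet> (A *\<^sub>v y) = (\<Sum>i<dim_row A. \<Sum>j<dim_col A. x $ i * A $$ (i, j) * y $ j)"
  using assms
  by (simp add: scalar_prod_def lessThan_atLeast0 sum_distrib_left mult.assoc)

lemma block_matrix_quadratic_form:
  assumes "x \<in> carrier_vec (\<Sum>k=1..m. s k)"
    and M: "\<And>k l. k \<in> {1..m} \<Longrightarrow> l \<in> {1..m} \<Longrightarrow> M k l \<in> carrier_mat (s k) (s l)"
  defines "y \<equiv> \<lambda>k. vec (s k) (\<lambda>a. x $ (block_offset s k + a))"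
  shows "x \<bullet> (block_matrix m s M *\<^sub>v x) = (\<Sum>k=1..m. \<Sum>l=1..m. y k \<bullet> (M k l *\<^sub>v y l))"
proof -
  let ?B = "block_matrix m s M" and ?o = "block_offset s"
  have B: "dim_row ?B = (\<Sum>k=1..m. s k)" "dim_col ?B = (\<Sum>k=1..m. s k)"
    by (simp_all add: block_matrix_def)
  have "x \<bullet> (?B *\<^sub>v x) = (\<Sum>k=1..m. \<Sum>a<s k. \<Sum>l=1..m. \<Sum>b<s l.
      x $ (?o k + a) * ?B $$ (?o k + a, ?o l + b) * x $ (?o l + b))"
    using assms(1) by (subst bilinear_form_sum) (simp_all only: B sum_blocks)
  also have "\<dots> = (\<Sum>k=1..m. \<Sum>l=1..m. \<Sum>a<s k. \<Sum>b<s l.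
      x $ (?o k + a) * ?B $$ (?o k + a, ?o l + b) * x $ (?o l + b))"
    by (intro sum.cong refl sum.swap)
  also have "\<dots> = (\<Sum>k=1..m. \<Sum>l=1..m. \<Sum>a<s k. \<Sum>b<s l. y k $ a * M k l $$ (a, b) * y l $ b)"
    by (intro sum.cong refl) (simp add: block_matrix_index y_def)
  also have "\<dots> = (\<Sum>k=1..m. \<Sum>l=1..m. y k \<bullet> (M k l *\<^sub>v y l))"
  proof (intro sum.cong refl)
    fix k l assume "k \<in> {1..m}" "l \<in> {1..m}"
    note carrier_matD [OF M [OF this]]
    then show "(\<Sum>a<s k. \<Sum>b<s l. y k $ a * M k l $$ (a, b) * y l $ b) = y k \<bullet> (M k l *\<^sub>v y l)"
      by (subst bilinear_form_sum) (simp_all add: y_def)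
  qed
  finally show ?thesis .
qed

lemma block_matrix_transpose:
  assumes M: "\<And>k l. k \<in> {1..m} \<Longrightarrow> l \<in> {1..m} \<Longrightarrow> M k l \<in> carrier_mat (s k) (s l)"
    and sym: "\<And>k l. k \<in> {1..m} \<Longrightarrow> l \<in> {1..m} \<Longrightarrow> (M k l)\<^sup>T = M l k"
  shows "(block_matrix m s M)\<^sup>T = block_matrix m s M"
proof (rule eq_matI)
  have B: "dim_row (block_matrix m s M) = (\<Sum>k=1..m. s k)"
    "dim_col (block_matrix m s M) = (\<Sum>k=1..m. s k)"
    by (simp_all add: block_matrix_def)
  fix i j
  assume "i < dim_row (block_matrix m s M)" "j < dim_col (block_matrix m s M)"
  then have ij: "i < (\<Sum>k=1..m. s k)" "j < (\<Sum>k=1..m. s k)" unfolding B by simp_all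
  obtain k a where ka: "1 \<le> k" "k \<le> m" "a < s k" "i = block_offset s k + a"
    using block_position [OF ij(1)] .
  obtain l b where lb: "1 \<le> l" "l \<le> m" "b < s l" "j = block_offset s l + b"
    using block_position [OF ij(2)] .
  have "(block_matrix m s M)\<^sup>T $$ (i, j) = block_matrix m s M $$ (j, i)"
    using ij B by simp
  also have "\<dots> = M l k $$ (b, a)" using ka lb by (simp add: block_matrix_index)
  also have "\<dots> = (M l k)\<^sup>T $$ (a, b)" using M [of l k] ka lb by simp
  also have "\<dots> = block_matrix m s M $$ (i, j)"
    using sym [of l k] ka lb by (simp add: block_matrix_index)
  finally show "(block_matrix m s M)\<^sup>T $$ (i, j) = block_matrix m s M $$ (i, j)" .
qed (simp_all add: block_matrix_def)

text \<open>
  With \<open>u k = E k y\<^sub>k\<close>, where the \<open>y\<^sub>k\<close> are the parts of the block vector, the form is the sum over the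
  coordinates \<open>t < D\<close> of the scalar form \<open>c\<close> at the numbers \<open>u k $ t\<close>. Every summand is nonnegative, and
  injectivity makes some \<open>u k $ t\<close> nonzero if the block vector is nonzero.
\<close>

lemma block_matrix_gram_positive_definite:
  assumes E: "\<And>k. k \<in> {1..m} \<Longrightarrow> E k \<in> carrier_mat D (s k)"
    and inj: "\<And>k. k \<in> {1..m} \<Longrightarrow> has_left_inverse (E k)"
    and c_sym: "\<And>k l. c k l = c l k"
    and c_pos: "\<And>w k. k \<in> {1..m} \<Longrightarrow> w k \<noteq> 0 \<Longrightarrow>
      (\<Sum>k=1..m. \<Sum>l=1..m. c k l * (w k * w l)) > (0 :: real)"
    and M: "\<And>k l. k \<in> {1..m} \<Longrightarrow> l \<in> {1..m} \<Longrightarrow> M k l = c k l \<cdot>\<^sub>m ((E k)\<^sup>T * E l)"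
  shows "positive_definite (block_matrix m s M)"
proof -
  let ?N = "\<Sum>k=1..m. s k"
  note Ed = carrier_matD [OF E]
  have carrier: "M k l \<in> carrier_mat (s k) (s l)" if "k \<in> {1..m}" "l \<in> {1..m}" for k l
    using that Ed by (intro carrier_matI) (simp_all add: M)
  have sym: "(M k l)\<^sup>T = M l k" if "k \<in> {1..m}" "l \<in> {1..m}" for k l
  proof -
    have "((E k)\<^sup>T * E l)\<^sup>T = (E l)\<^sup>T * E k"
      using that Ed by (simp add: transpose_mult_dim)
    moreover have "(a \<cdot>\<^sub>m B)\<^sup>T = a \<cdot>\<^sub>m B\<^sup>T" for a and B :: "real mat"
      by (rule eq_matI) simp_all
    ultimately show ?thesis using that c_sym [of k l] by (simp add: M)
  qed
  have "x \<bullet> (block_matrix m s M *\<^sub>v x) > 0"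
    if x: "x \<in> carrier_vec ?N" "x \<noteq> 0\<^sub>v ?N" for x
  proof -
    define y where "y = (\<lambda>k. vec (s k) (\<lambda>a. x $ (block_offset s k + a)))"
    define u where "u = (\<lambda>k. E k *\<^sub>v y k)"
    have y: "y k \<in> carrier_vec (s k)" for k by (simp add: y_def)
    have u: "u k \<in> carrier_vec D" if "k \<in> {1..m}" for k
      using E [OF that] y by (simp add: u_def mult_mat_vec_carrier)
    have form: "y k \<bullet> (M k l *\<^sub>v y l) = (\<Sum>t<D. c k l * (u k $ t * u l $ t))"
      if kl: "k \<in> {1..m}" "l \<in> {1..m}" for k l
    proof -
      have Ek: "(E k)\<^sup>T \<in> carrier_mat (s k) D" using E [OF kl(1)] by simp
      have prod: "(E k)\<^sup>T * E l \<in> carrier_mat (s k) (s l)"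
        using Ek E [OF kl(2)] by (rule mult_carrier_mat)
      have "y k \<bullet> (M k l *\<^sub>v y l) = c k l * (y k \<bullet> (((E k)\<^sup>T * E l) *\<^sub>v y l))"
      proof -
        have "y k \<bullet> ((b \<cdot>\<^sub>m B) *\<^sub>v y l) = b * (y k \<bullet> (B *\<^sub>v y l))"
          if "B \<in> carrier_mat (s k) (s l)" for b B
          using that y [of k] y [of l]
          by (auto simp: bilinear_form_sum sum_distrib_left mult.assoc mult.left_commute)
        from this [OF prod] show ?thesis using kl by (simp add: M)
      qed
      also have "((E k)\<^sup>T * E l) *\<^sub>v y l = (E k)\<^sup>T *\<^sub>v u l"
        unfolding u_def using Ek E [OF kl(2)] y by (rule assoc_mult_mat_vec)
      also have "y k \<bullet> ((E k)\<^sup>T *\<^sub>v u l) = u k \<bullet> u l"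
        using transpose_vec_mult_scalar [OF Ek u [OF kl(2)] y [of k]] by (simp add: u_def)
      also have "c k l * (u k \<bullet> u l) = (\<Sum>t<D. c k l * (u k $ t * u l $ t))"
        using u [OF kl(2)] by (simp add: scalar_prod_def lessThan_atLeast0 sum_distrib_left)
      finally show ?thesis .
    qed
    let ?q = "\<lambda>t. \<Sum>k=1..m. \<Sum>l=1..m. c k l * (u k $ t * u l $ t)"
    have "x \<bullet> (block_matrix m s M *\<^sub>v x) = (\<Sum>k=1..m. \<Sum>l=1..m. y k \<bullet> (M k l *\<^sub>v y l))"
      unfolding y_def by (rule block_matrix_quadratic_form [OF x(1) carrier])
    also have "\<dots> = (\<Sum>k=1..m. \<Sum>l=1..m. \<Sum>t<D. c k l * (u k $ t * u l $ t))"
      by (intro sum.cong refl form)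
    also have "\<dots> = (\<Sum>k=1..m. \<Sum>t<D. \<Sum>l=1..m. c k l * (u k $ t * u l $ t))"
      by (intro sum.cong refl sum.swap)
    also have "\<dots> = (\<Sum>t<D. ?q t)" by (rule sum.swap)
    also have "\<dots> > 0"
    proof -
      obtain i where i: "i < ?N" "x $ i \<noteq> 0"
        using x by (metis carrier_vecD eq_vecI index_zero_vec)
      obtain k a where ka: "1 \<le> k" "k \<le> m" "a < s k" "i = block_offset s k + a"
        using block_position [OF i(1)] .
      then have k: "k \<in> {1..m}" by simp
      have "y k $ a \<noteq> 0" using ka i by (simp add: y_def)
      then have "y k \<noteq> 0\<^sub>v (s k)" using ka by auto
      then have "u k \<noteq> 0\<^sub>v D"
        using left_inverse_kernel [OF inj [OF k], of "y k"] y [of k] Ed [OF k] by (auto simp: u_def)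
      then obtain t where t: "t < D" "u k $ t \<noteq> 0"
        using u [OF k] by (metis carrier_vecD eq_vecI index_zero_vec)
      have "?q t > 0" using c_pos [OF k, of "\<lambda>k. u k $ t"] t by simp
      moreover have "?q t' \<ge> 0" for t'
      proof (cases "\<exists>k\<in>{1..m}. u k $ t' \<noteq> 0")
        case True
        then show ?thesis using c_pos [of _ "\<lambda>k. u k $ t'"] by force
      qed simp
      ultimately show ?thesis using t by (intro sum_pos2 [of "{..<D}" t]) auto
    qed
    finally show ?thesis .
  qed
  then show ?thesis
    using block_matrix_transpose [of m M s, OF carrier sym]
    by (simp add: positive_definite_def block_matrix_def)
qed

theorem lemma2p3:
  fixes d :: nat and n r :: "nat \<Rightarrow> nat" and X :: "nat \<Rightarrow> tensor3"
  assumes "d \<ge> 2"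
    and "\<And>k. k \<in> {1..d} \<Longrightarrow> n k \<ge> 1"
    and "r 0 = 1" and "r d = 1"
    and "\<And>k. k \<in> {0..d} \<Longrightarrow> r k \<ge> 1"
    and "\<And>k. k \<in> {1..d} \<Longrightarrow> r (k - 1) \<le> n k * r k"
    and "\<And>k. k \<in> {1..d} \<Longrightarrow> r k \<le> n k * r (k - 1)"
    and "X \<in> total_space d n r"
  shows "positive_definite (tridiag_matrix d n r X)"
  unfolding tridiag_matrix_def
proof (rule block_matrix_gram_positive_definite)
  let ?E = "insertion d n r X" and ?m = "d - 1"
  fix k
  assume k: "k \<in> {1..?m}"
  then have "k \<le> d" by auto
  then show "?E k \<in> carrier_mat (\<Prod>l=1..d. n l) ((r k)\<^sup>2)" by (rule insertion_carrier)
  show "has_left_inverse (?E k)"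
    unfolding insertion_def using assms \<open>k \<le> d\<close>
    by (intro left_inverse_kron left_inverse_interface_le left_inverse_interface_ge) auto
  show "(\<Sum>k=1..?m. \<Sum>l=1..?m. coupling k l * (w k * w l)) > 0" if "w k \<noteq> 0" for w
    using k that by (rule coupling_pos)
  fix l
  assume l: "l \<in> {1..?m}"
  then have "l \<le> d" by auto
  have B: "block_B d n r X j = (- 1 / 2) \<cdot>\<^sub>m ((?E j)\<^sup>T * ?E (j + 1))" if "j + 1 \<in> {1..?m}" for j
    using assms that by (intro block_B_gram) auto
  consider "l = k" | "l = k + 1" | "k = l + 1" | "l \<noteq> k" "l \<noteq> k + 1" "k \<noteq> l + 1" by blast
  then show "tridiag_block d n r X k l = coupling k l \<cdot>\<^sub>m ((?E k)\<^sup>T * ?E l)"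
  proof cases
    case 1
    then show ?thesis
      by (intro eq_matI) (simp_all add: tridiag_block_def coupling_def block_A_gram)
  next
    case 2
    then show ?thesis using B [of k] l by (simp add: tridiag_block_def coupling_def)
  next
    case 3
    have "(?E k)\<^sup>T * ?E l = ((?E l)\<^sup>T * ?E k)\<^sup>T"
      using insertion_carrier [OF \<open>k \<le> d\<close>, of n r X] insertion_carrier [OF \<open>l \<le> d\<close>, of n r X]
      by (subst transpose_mult_dim) auto
    moreover have "((- 1 / 2) \<cdot>\<^sub>m A)\<^sup>T = (- 1 / 2) \<cdot>\<^sub>m A\<^sup>T" for A :: "real mat"
      by (rule eq_matI) simp_all
    ultimately show ?thesis
      using 3 B [of l] k by (simp add: tridiag_block_def coupling_def)
  next
    case 4
    then show ?thesis
      using carrier_matD [OF insertion_carrier [OF \<open>k \<le> d\<close>, of n r X]]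
        carrier_matD [OF insertion_carrier [OF \<open>l \<le> d\<close>, of n r X]]
      by (intro eq_matI) (simp_all add: tridiag_block_def coupling_def)
  qed
qed (rule coupling_commute)

end
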